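(* Let $D=(d_{ij})$ be an $n\times n$ distance matrix. Then $D$ has a realization by an $n$-cycle if and only if there exists a real permutation $\pi$ of $[n]$ such that \[ d_{i\,\pi^s(i)}=\min\left\{\sum_{t=0}^{s-1} d_{\pi^t(i)\,\pi^{t+1}(i)},\ \sum_{t=s}^{n-1} d_{\pi^t(i)\,\pi^{t+1}(i)}\right\} \] for all $i=1,\dots,n$ and all $s=1,\dots,n-1$.
   Context: A distance matrix is a real symmetric $n\times n$ matrix $D=(d_{ij})$ with nonnegative entries, zero diagonal, and $d_{ij}\le d_{ik}+d_{kj}$ for all $i,j,k\in[n]=\{1,\dots,n\}$. A realization of $D$ by an $n$-cycle is a weighted graph (nonnegative edge weights) which is a cycle with vertex set exactly $[n]$, such that for all $i,j\in[n]$ the length of a shortest path between $i$ and $j$ equals $d_{ij}$. A permutation $\pi$ of $[n]$ is called real if its cycle decomposition consists of a single cycle of length $n$. Here $\pi^0$ is the identity and $\pi^n(i)=i$. *)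

theory Defs
  imports "HOL-Analysis.Analysis" "HOL-Combinatorics.Cycles"
begin

text \<open>The index set \<open>[n]\<close> is a finite type \<open>'n\<close> with \<open>CARD('n) = n\<close>.\<close>

definition distance_matrix :: "real ^ 'n ^ 'n \<Rightarrow> bool" where
  "distance_matrix D \<longleftrightarrow>
     (\<forall>i j. D $ i $ j = D $ j $ i) \<and>
     (\<forall>i j. 0 \<le> D $ i $ j) \<and>
     (\<forall>i. D $ i $ i = 0) \<and>
     (\<forall>i j k. D $ i $ j \<le> D $ i $ k + D $ k $ j)"

text \<open>
  Undirected graphs with edge weights. Edges have identities of their own, so that parallel edges
  and loops (an edge with a single end) are possible. They are needed only for the cycles with one
  or two vertices; a cycle with at least three vertices is automatically a simple graph.
\<close>

record ('v, 'e) wgraph =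
  verts :: "'v set"
  edges :: "'e set"
  ends :: "'e \<Rightarrow> 'v set"
  weight :: "'e \<Rightarrow> real"

definition weighted_graph :: "('v, 'e) wgraph \<Rightarrow> bool" where
  "weighted_graph G \<longleftrightarrow>
     (\<forall>e \<in> edges G. ends G e \<subseteq> verts G \<and> card (ends G e) \<in> {1, 2} \<and> 0 \<le> weight G e)"

text \<open>A path is the pair of its list of vertices and its list of edges.\<close>

definition is_path :: "('v, 'e) wgraph \<Rightarrow> 'v \<Rightarrow> 'v \<Rightarrow> 'v list \<times> 'e list \<Rightarrow> bool" where
  "is_path G u v = (\<lambda>(vs, es).
     length vs = Suc (length es) \<and> hd vs = u \<and> last vs = v \<and>
     distinct vs \<and> set vs \<subseteq> verts G \<and> set es \<subseteq> edges G \<and>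
     (\<forall>k < length es. ends G (es ! k) = {vs ! k, vs ! Suc k}))"

definition path_length :: "('v, 'e) wgraph \<Rightarrow> 'v list \<times> 'e list \<Rightarrow> real" where
  "path_length G p = sum_list (map (weight G) (snd p))"

definition is_shortest_path :: "('v, 'e) wgraph \<Rightarrow> 'v \<Rightarrow> 'v \<Rightarrow> 'v list \<times> 'e list \<Rightarrow> bool" where
  "is_shortest_path G u v p \<longleftrightarrow> is_arg_min (path_length G) (is_path G u v) p"

definition is_cycle_graph :: "('v, 'e) wgraph \<Rightarrow> bool" where
  "is_cycle_graph G \<longleftrightarrow>
     (\<exists>vs es. vs \<noteq> [] \<and> distinct vs \<and> distinct es \<and> length es = length vs \<and>
        set vs = verts G \<and> set es = edges G \<and>
        (\<forall>k < length vs. ends G (es ! k) = {vs ! k, vs ! (Suc k mod length vs)}))"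

text \<open>
  Every finite graph is isomorphic to one whose edges are natural numbers, so the choice of
  the type of edges is no restriction.
\<close>

definition has_cycle_realization :: "real ^ 'n ^ 'n \<Rightarrow> bool" where
  "has_cycle_realization D \<longleftrightarrow>
     (\<exists>G :: ('n, nat) wgraph.
        weighted_graph G \<and> is_cycle_graph G \<and> verts G = UNIV \<and>
        (\<forall>i j. \<exists>p. is_shortest_path G i j p \<and> path_length G p = D $ i $ j))"

definition real_permutation :: "('n::finite \<Rightarrow> 'n) \<Rightarrow> bool" where
  "real_permutation \<pi> \<longleftrightarrow>
     (\<exists>cs. cycle cs \<and> length cs = CARD('n) \<and> \<pi> = cycle_of_list cs)"

end

theory Submission
  imports Defs
begin

text \<open>
  Label the vertices of a cycle graph cyclically and measure from a base vertex \<open>v 0\<close>. The distance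
  to \<open>v s\<close> is the shorter of the two arcs: both arcs are paths, and the function sending a vertex
  to its shorter arc is 1-Lipschitz along edges, so no path is shorter. Hence a permutation as in
  the theorem yields a realization whose edge weights are the distances of consecutive vertices.

  Conversely, in a realization with weights \<open>w\<close> and total weight \<open>W\<close>, consecutive vertices have
  distance \<open>min (w k) (W - w k)\<close>, which may differ from \<open>w k\<close> for at most one heavy edge. Replacing
  that weight does not matter: the heavy edge lies on the longer arc before and after.
\<close>

section \<open>Cyclic labellings\<close>

text \<open>Moving the window by one step trades the value at \<open>a\<close> for the equal value
  at \<open>a + n\<close>, so the image stays \<open>S\<close>. Injectivity then follows by
  counting.\<close>

lemma bij_betw_periodic_shift:
  fixes f :: "nat \<Rightarrow> 'a"
  assumes period: "\<And>k. f (k + n) = f k" and bij: "bij_betw f {..<n} S"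
  shows "bij_betw (\<lambda>k. f (a + k)) {..<n} S"
proof (induction a)
  case 0
  then show ?case using bij by simp
next
  case (Suc a)
  let ?g = "\<lambda>k. f (a + k)"
  show ?case
  proof (cases n)
    case 0
    then show ?thesis using bij by (simp add: bij_betw_def)
  next
    case (Suc m)
    have g: "?g n = ?g 0" using period[of a] by simp
    have "(\<lambda>k. f (Suc a + k)) ` {..<n} = ?g ` (Suc ` {..<n})"
      by (simp add: image_image)
    also have "\<dots> = ?g ` insert n (Suc ` {..<m})"
      using Suc by (simp add: lessThan_Suc)
    also have "\<dots> = ?g ` insert 0 (Suc ` {..<m})"
      using g by simp
    also have "insert 0 (Suc ` {..<m}) = {..<n}"
      using Suc lessThan_Suc_eq_insert_0 by simp
    also have "?g ` {..<n} = S"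
      using Suc.IH by (simp add: bij_betw_def)
    finally have "(\<lambda>k. f (Suc a + k)) ` {..<n} = S" .
    moreover have "card S = card {..<n}"
      using bij_betw_same_card[OF bij] by simp
    ultimately show ?thesis
      by (simp add: bij_betw_def eq_card_imp_inj_on)
  qed
qed

text \<open>Indices run periodically over all naturals, so a change of base vertex is a mere shift
  and arcs past the base need no modular arithmetic. For \<open>n = 1\<close> the edge is a loop,
  for \<open>n = 2\<close> the two edges are parallel.\<close>

locale cyclic_labelling =
  fixes G :: "('v, 'e) wgraph" and v :: "nat \<Rightarrow> 'v" and e :: "nat \<Rightarrow> 'e" and n :: nat
  assumes weighted: "weighted_graph G"
    and bij_v: "bij_betw v {..<n} (verts G)"
    and bij_e: "bij_betw e {..<n} (edges G)"
    and period_v: "v (k + n) = v k"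
    and period_e: "e (k + n) = e k"
    and ends: "ends G (e k) = {v k, v (Suc k)}"
begin

abbreviation arc :: "nat \<Rightarrow> nat \<Rightarrow> real" where
  "arc s t \<equiv> (\<Sum>k = s..<t. weight G (e k))"

text \<open>Any vertex may serve as the base, so distances need only be computed from
  \<open>v 0\<close>.\<close>

lemma shift: "cyclic_labelling G (\<lambda>k. v (a + k)) (\<lambda>k. e (a + k)) n"
proof
  show "v (a + (k + n)) = v (a + k)" "e (a + (k + n)) = e (a + k)" for k
    using period_v[of "a + k"] period_e[of "a + k"] by (simp_all add: add.assoc)
qed (use weighted bij_betw_periodic_shift[OF period_v bij_v]
      bij_betw_periodic_shift[OF period_e bij_e] ends in simp_all)

lemma period: "v n = v 0"
  using period_v[of 0] by simp

lemma vertex: "k \<le> n \<Longrightarrow> 0 < n \<Longrightarrow> v k \<in> verts G"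
  using bij_betwE[OF bij_v] period by (cases "k = n") auto

lemma edge: "k < n \<Longrightarrow> e k \<in> edges G"
  using bij_betwE[OF bij_e] by auto

lemma weight_nonneg: "d \<in> edges G \<Longrightarrow> 0 \<le> weight G d"
  using weighted by (simp add: weighted_graph_def)

lemma arc_nonneg: "t \<le> n \<Longrightarrow> 0 \<le> arc s t"
  by (auto intro!: sum_nonneg weight_nonneg edge)

text \<open>The sum over \<open>edges G\<close> shows that the total does not depend on the base
  vertex.\<close>

lemma total_weight: "arc 0 n = sum (weight G) (edges G)"
  using sum.reindex_bij_betw[OF bij_e, of "weight G"] by (simp add: atLeast0LessThan)

lemma arc_split: "s \<le> n \<Longrightarrow> arc 0 s + arc s n = sum (weight G) (edges G)"
  using total_weight by (simp add: sum.atLeastLessThan_concat)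

text \<open>The last assumption excludes the full turn from \<open>v 0\<close> to
  \<open>v n\<close>, which would visit the base twice. The case \<open>t = n\<close> is kept: it
  gives the arc that closes up at the base.\<close>

lemma arc_is_path:
  assumes "s \<le> t" "t \<le> n" "0 < n" "0 < s \<or> t < n"
  shows "is_path G (v s) (v t) (map v [s..<Suc t], map e [s..<t])"
proof -
  have inj: "inj_on v {..<n}" using bij_v by (simp add: bij_betw_def)
  have "inj_on v {s..<Suc t}"
  proof (cases "t < n")
    case True
    then show ?thesis by (intro inj_on_subset[OF inj]) auto
  next
    case False
    then have [simp]: "t = n" and "0 < s" using assms by auto
    have "inj_on v {s..<n}" by (intro inj_on_subset[OF inj]) auto
    moreover have "v n \<notin> v ` {s..<n}"
      using \<open>0 < s\<close> by (auto simp: period inj_on_eq_iff[OF inj])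
    moreover have "{s..<Suc t} = insert n {s..<n}" using assms by auto
    ultimately show ?thesis by simp
  qed
  then have "distinct (map v [s..<Suc t])" unfolding distinct_map by (simp del: upt_Suc)
  moreover have "hd (map v [s..<Suc t]) = v s" "last (map v [s..<Suc t]) = v t"
    using assms by (auto simp: hd_map hd_append)
  moreover have "set (map v [s..<Suc t]) \<subseteq> verts G" "set (map e [s..<t]) \<subseteq> edges G"
    using assms by (auto intro: vertex edge)
  moreover have "ends G (map e [s..<t] ! k) = {map v [s..<Suc t] ! k, map v [s..<Suc t] ! Suc k}"
    if "k < t - s" for k
    using that ends[of "s + k"] by (simp add: nth_append del: upt_Suc)
  ultimately show ?thesis
    using assms unfolding is_path_def by (simp del: upt_Suc)
qed

lemma path_length_arc: "path_length G (us, map e [s..<t]) = arc s t"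
  by (simp add: path_length_def comp_def interv_sum_list_conv_sum_set_nat)

end

section \<open>Shortest paths: potentials bound lengths from below, arcs attain the bound\<close>

lemma is_path_rev:
  assumes "is_path G a b (us, ds)"
  shows "is_path G b a (rev us, rev ds)"
proof -
  have len: "length us = Suc (length ds)"
    and ends: "\<And>k. k < length ds \<Longrightarrow> ends G (ds ! k) = {us ! k, us ! Suc k}"
    using assms by (auto simp: is_path_def)
  have "ends G (rev ds ! k) = {rev us ! k, rev us ! Suc k}" if "k < length ds" for k
    using ends[of "length ds - Suc k"] that len by (simp add: rev_nth Suc_diff_Suc insert_commute)
  moreover have "us \<noteq> []" using len by auto
  ultimately show ?thesis
    using assms by (auto simp: is_path_def hd_rev last_rev)
qed

text \<open>The differences of \<open>f\<close> telescope along the path. As \<open>{x, y}\<close>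
  is unordered, \<open>lip\<close> bounds the change along an edge in both directions.\<close>

lemma path_length_ge_potential:
  fixes f :: "'v \<Rightarrow> real"
  assumes lip: "\<And>d x y. d \<in> edges G \<Longrightarrow> ends G d = {x, y} \<Longrightarrow> f y - f x \<le> weight G d"
    and "is_path G a b (us, ds)"
  shows "f b - f a \<le> path_length G (us, ds)"
  using assms(2)
proof (induction ds arbitrary: us a)
  case Nil
  then have "a = b" by (cases us) (auto simp: is_path_def)
  then show ?case by (simp add: path_length_def)
next
  case (Cons d ds)
  then obtain c us' where us: "us = a # c # us'"
    by (cases us; cases "tl us") (auto simp: is_path_def)
  have "is_path G c b (c # us', ds)"
    using Cons.prems unfolding us is_path_def by (auto simp: nth_Cons' dest: spec[of _ "Suc _"])
  then have "f b - f c \<le> path_length G (c # us', ds)" by (rule Cons.IH)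
  moreover have "f c - f a \<le> weight G d"
    using Cons.prems unfolding us is_path_def by (intro lip) auto
  ultimately show ?case by (simp add: path_length_def)
qed

context cyclic_labelling
begin

lemma path_length_ge_arc:
  assumes "s < n" and path: "is_path G (v 0) (v s) p"
  shows "min (arc 0 s) (arc s n) \<le> path_length G p"
proof -
  \<comment> \<open>\<open>g\<close> is the claimed distance from the base as a function of the
    index; \<open>f\<close> carries it over to the vertices and serves as the potential.\<close>
  define g where "g k = min (arc 0 k) (arc k n)" for k
  define f where "f = g \<circ> the_inv_into {..<n} v"
  have n: "0 < n" using assms by simp
  have inj: "inj_on v {..<n}" using bij_v by (simp add: bij_betw_def)
  have g0: "g 0 = 0" using arc_nonneg[of n 0] by (simp add: g_def)
  moreover have "g n = 0" using arc_nonneg[of n 0] by (simp add: g_def)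
  \<comment> \<open>Because \<open>g\<close> also vanishes at \<open>n\<close>, the formula extends
    to \<open>k = n\<close>, and \<open>step\<close> can treat the closing edge like any
    other.\<close>
  ultimately have f: "f (v k) = g k" if "k \<le> n" for k
    using that n period the_inv_into_f_f[OF inj] by (cases "k = n") (auto simp: f_def)
  \<comment> \<open>Passing an edge lengthens one arc and shortens the other by its weight, so the
    minimum changes by at most that weight.\<close>
  have step: "\<bar>f (v (Suc k)) - f (v k)\<bar> \<le> weight G (e k)" if "k < n" for k
  proof -
    have "arc k n = weight G (e k) + arc (Suc k) n"
      using that by (rule sum.atLeast_Suc_lessThan)
    then show ?thesis
      using that f[of k] f[of "Suc k"] weight_nonneg[OF edge[OF that]] by (simp add: g_def)
  qed
  have lip: "f y - f x \<le> weight G d" if d: "d \<in> edges G" "ends G d = {x, y}" for d x y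
  proof -
    obtain k where k: "k < n" "d = e k"
      using d(1) bij_e by (auto simp: bij_betw_def)
    then have "{x, y} = {v k, v (Suc k)}" using d(2) ends by simp
    then have "x = v k \<and> y = v (Suc k) \<or> x = v (Suc k) \<and> y = v k"
      by (simp add: doubleton_eq_iff)
    then show ?thesis using step[OF k(1)] k(2) by auto
  qed
  have "f (v s) - f (v 0) \<le> path_length G p"
    using path_length_ge_potential[of G f "v 0" "v s" "fst p" "snd p"] lip path by simp
  then show ?thesis using f[of s] f[of 0] g0 assms(1) by (simp add: g_def)
qed

lemma ex_path_arc:
  assumes "s < n"
  shows "\<exists>p. is_path G (v 0) (v s) p \<and> path_length G p = min (arc 0 s) (arc s n)"
proof (cases "arc 0 s \<le> arc s n")
  case True
  then show ?thesis
    using arc_is_path[of 0 s] assms by (intro exI conjI) (auto simp: path_length_arc)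
next
  case False
  \<comment> \<open>For \<open>s = 0\<close> the first arc is empty and cannot be the longer one.
    The second arc runs from \<open>v s\<close> to \<open>v n = v 0\<close> and has to be
    reversed.\<close>
  then have "0 < s" using arc_nonneg[of n s] by (cases s) auto
  then have "is_path G (v s) (v n) (map v [s..<Suc n], map e [s..<n])"
    using arc_is_path[of s n] assms by simp
  then have "is_path G (v 0) (v s) (rev (map v [s..<Suc n]), rev (map e [s..<n]))"
    using is_path_rev period by metis
  moreover have "path_length G (rev (map v [s..<Suc n]), rev (map e [s..<n])) = arc s n"
    using path_length_arc[of "[]" s n]
    by (simp add: path_length_def flip: rev_map)
  ultimately show ?thesis using False by (intro exI conjI) auto
qed

text \<open>The equivalence serves both directions of the theorem: one reads distances off given
  shortest paths, the other must exhibit such paths.\<close>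

lemma shortest_path_base:
  assumes "s < n"
  shows "(\<exists>p. is_shortest_path G (v 0) (v s) p \<and> path_length G p = x) \<longleftrightarrow>
    x = min (arc 0 s) (arc s n)"
proof -
  obtain q where q: "is_path G (v 0) (v s) q" "path_length G q = min (arc 0 s) (arc s n)"
    using ex_path_arc[OF assms] by blast
  have ge: "path_length G q \<le> path_length G p" if "is_path G (v 0) (v s) p" for p
    using path_length_ge_arc[OF assms that] q(2) by simp
  have "is_shortest_path G (v 0) (v s) q"
    unfolding is_shortest_path_def is_arg_min_linorder using q(1) ge by blast
  moreover have "path_length G p = path_length G q" if "is_shortest_path G (v 0) (v s) p" for p
    using that q(1) ge unfolding is_shortest_path_def is_arg_min_linorder by (meson order_antisym)
  ultimately show ?thesis using q(2) by metis
qed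

lemma shortest_path:
  assumes "s < n"
  shows "(\<exists>p. is_shortest_path G (v a) (v (a + s)) p \<and> path_length G p = x) \<longleftrightarrow>
    x = min (\<Sum>t = 0..<s. weight G (e (a + t))) (\<Sum>t = s..<n. weight G (e (a + t)))"
  using cyclic_labelling.shortest_path_base[OF shift[of a] assms, of x] by simp

end

section \<open>Replacing a heavy edge\<close>

text \<open>\<open>A\<close> and \<open>B\<close> index the two arcs between two vertices. If
  \<open>k \<in> A\<close> is heavy, that is \<open>W - w k < w k\<close>, all other weights are at
  most \<open>W - w k\<close> and stay unchanged. The sum over \<open>B\<close> remains the minimum,
  since \<open>d k = W - w k\<close> is at least that sum.\<close>

lemma min_sum_replace_heavy:
  fixes w :: "'a \<Rightarrow> real"
  assumes fin: "finite A" "finite B" and disj: "A \<inter> B = {}"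
    and nonneg: "\<And>k. k \<in> A \<union> B \<Longrightarrow> 0 \<le> w k"
    and W: "W = sum w A + sum w B"
    and d: "\<And>k. k \<in> A \<union> B \<Longrightarrow> d k = min (w k) (W - w k)"
  shows "min (sum w A) (sum w B) = min (sum d A) (sum d B)"
proof -
  \<comment> \<open>The assumptions are restated for arbitrary \<open>A\<close> and \<open>B\<close>
    so that the two sets can be exchanged below.\<close>
  have heavy: "min (sum w A) (sum w B) = min (sum d A) (sum d B)"
    if fin: "finite A" "finite B" and disj: "A \<inter> B = {}"
      and nonneg: "\<And>k. k \<in> A \<union> B \<Longrightarrow> 0 \<le> w k"
      and W: "W = sum w A + sum w B"
      and d: "\<And>k. k \<in> A \<union> B \<Longrightarrow> d k = min (w k) (W - w k)"
      and k: "k \<in> A" "W - w k < w k" for A B k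
  proof -
    have A: "sum f A = f k + sum f (A - {k})" for f :: "'a \<Rightarrow> real"
      using k(1) fin(1) by (simp add: sum.remove)
    have rest: "W - w k = sum w (A - {k}) + sum w B" using W A[of w] by simp
    have pos: "0 \<le> sum w (A - {k})" "0 \<le> sum w B"
      using nonneg by (auto intro!: sum_nonneg)
    have light: "d j = w j" if j: "j \<in> A \<union> B" "j \<noteq> k" for j
    proof -
      have "w j \<le> W - w k"
      proof (cases "j \<in> A")
        case True
        then have "w j \<le> sum w (A - {k})"
          using j fin nonneg by (intro member_le_sum) auto
        then show ?thesis using rest pos by simp
      next
        case False
        then have "w j \<le> sum w B" using j fin nonneg by (intro member_le_sum) auto
        then show ?thesis using rest pos by simp
      qed
      then show ?thesis using d[OF j(1)] k(2) by simp
    qed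
    have "sum d B = sum w B" using light k(1) disj by (intro sum.cong) auto
    moreover have "sum d (A - {k}) = sum w (A - {k})" using light by (intro sum.cong) auto
    moreover have "d k = W - w k" using d[of k] k by simp
    ultimately show ?thesis using A[of w] A[of d] rest pos k(2) by simp
  qed
  consider k where "k \<in> A" "W - w k < w k" | k where "k \<in> B" "W - w k < w k"
    | "\<forall>k \<in> A \<union> B. w k \<le> W - w k"
    by (meson UnE not_le)
  then show ?thesis
  proof cases
    case 1
    then show ?thesis using heavy[OF fin disj nonneg W d] by simp
  next
    case 2
    have "min (sum w B) (sum w A) = min (sum d B) (sum d A)"
      by (rule heavy[of B A k]) (use fin disj nonneg W d 2 in auto)
    then show ?thesis by (simp add: min.commute)
  next
    case 3
    then have "sum d A = sum w A" "sum d B = sum w B"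
      using d by (auto intro!: sum.cong)
    then show ?thesis by simp
  qed
qed

section \<open>Permutations and cycle graphs\<close>

lemma cycle_of_list_funpow_nth:
  assumes "cycle cs" "k < length cs"
  shows "(cycle_of_list cs ^^ t) (cs ! k) = cs ! ((k + t) mod length cs)"
proof -
  have "(cycle_of_list cs ^^ t) (cs ! k) = map (cycle_of_list cs ^^ t) cs ! k"
    using assms by simp
  also have "\<dots> = rotate t cs ! k" using cyclic_rotation[OF assms(1)] by simp
  finally show ?thesis using assms by (simp add: nth_rotate add.commute)
qed

text \<open>Iterating \<pi> walks along the list, \<open>(\<pi> ^^ t) (v a) = v (a + t)\<close>, and
  every \<open>i\<close> is some \<open>v a\<close>. This turns the condition on \<pi> into one on a
  periodic labelling.\<close>

lemma real_permutation_condition_iff: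
  fixes D :: "real ^ 'n ^ 'n" and cs :: "'n list"
  assumes cs: "cycle cs" "length cs = CARD('n)"
  defines "v \<equiv> \<lambda>k. cs ! (k mod CARD('n))" and "\<pi> \<equiv> cycle_of_list cs"
  shows "(\<forall>i. \<forall>s \<in> {1..CARD('n) - 1}.
         D $ i $ (\<pi> ^^ s) i =
           min (\<Sum>t = 0..s - 1. D $ (\<pi> ^^ t) i $ (\<pi> ^^ (t + 1)) i)
               (\<Sum>t = s..CARD('n) - 1. D $ (\<pi> ^^ t) i $ (\<pi> ^^ (t + 1)) i)) \<longleftrightarrow>
    (\<forall>a. \<forall>s. 0 < s \<and> s < CARD('n) \<longrightarrow>
         D $ v a $ v (a + s) =
           min (\<Sum>t = 0..<s. D $ v (a + t) $ v (Suc (a + t)))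
               (\<Sum>t = s..<CARD('n). D $ v (a + t) $ v (Suc (a + t))))"
proof -
  have pow: "(\<pi> ^^ t) (v a) = v (a + t)" for t a
    using cycle_of_list_funpow_nth[OF cs(1), of "a mod CARD('n)" t] cs(2)
    by (simp add: v_def \<pi>_def mod_add_left_eq)
  have "set cs = UNIV"
    using cs by (metis card_subset_eq distinct_card finite_class.finite_UNIV subset_UNIV)
  then have surj: "\<exists>a. i = v a" for i
    using cs(2) by (metis UNIV_I in_set_conv_nth mod_less v_def)
  have all: "(\<forall>i. P i) \<longleftrightarrow> (\<forall>a. P (v a))" for P
    using surj by metis
  \<comment> \<open>At \<open>s = 0\<close> truncated subtraction would make the first equation
    false.\<close>
  have ivl: "{0..s - Suc 0} = {0..<s}" "{s..CARD('n) - Suc 0} = {s..<CARD('n)}"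
    if "0 < s" "s < CARD('n)" for s
    using that by auto
  have ball: "(\<forall>s \<in> {1..CARD('n) - 1}. P s) \<longleftrightarrow> (\<forall>s. 0 < s \<and> s < CARD('n) \<longrightarrow> P s)" for P
    by (auto simp: Ball_def Suc_le_eq le_diff_conv2 intro: less_imp_le)
  show ?thesis
    unfolding all ball by (intro all_cong1 imp_cong refl) (simp add: ivl pow del: funpow.simps)
qed

text \<open>The list itself is exposed because the permutation of the theorem is built from
  it.\<close>

lemma labelling_of_cycle_graph:
  assumes "weighted_graph G" "is_cycle_graph G"
  obtains vs e where "distinct vs" "set vs = verts G"
    "cyclic_labelling G (\<lambda>k. vs ! (k mod length vs)) e (length vs)"
proof -
  obtain vs es where *: "vs \<noteq> []" "distinct vs" "distinct es" "length es = length vs"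
    "set vs = verts G" "set es = edges G"
    "\<And>k. k < length vs \<Longrightarrow> ends G (es ! k) = {vs ! k, vs ! (Suc k mod length vs)}"
    using assms(2) unfolding is_cycle_graph_def by blast
  have bij: "bij_betw (\<lambda>k. xs ! (k mod length vs)) {..<length vs} (set xs)"
    if "distinct xs" "length xs = length vs" for xs :: "'x list"
    using bij_betw_nth[OF that(1), of "{..<length vs}" "set xs"] that(2)
    by (subst bij_betw_cong[where g = "(!) xs"]) auto
  have "cyclic_labelling G (\<lambda>k. vs ! (k mod length vs)) (\<lambda>k. es ! (k mod length vs)) (length vs)"
    using assms(1) bij[of vs] bij[of es] * by unfold_locales (auto simp: mod_Suc_eq)
  then show ?thesis using that * by blast
qed

lemma cycle_graph_of_list:
  fixes cs :: "'n::finite list" and w :: "nat \<Rightarrow> real"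
  assumes cs: "distinct cs" "length cs = CARD('n)"
    and nonneg: "\<And>k. 0 \<le> w k"
  defines "v \<equiv> \<lambda>k. cs ! (k mod CARD('n))"
  obtains G :: "('n, nat) wgraph" where "is_cycle_graph G" "verts G = UNIV" "weight G = w"
    "cyclic_labelling G v (\<lambda>k. k mod CARD('n)) CARD('n)"
proof -
  \<comment> \<open>Edge \<open>k\<close> joins positions \<open>k\<close> and \<open>k + 1\<close>.
    Numbered edges give a loop for one vertex and two parallel edges for two.\<close>
  define G :: "('n, nat) wgraph" where
    "G = \<lparr>verts = UNIV, edges = {..<CARD('n)}, ends = (\<lambda>k. {v k, v (Suc k)}), weight = w\<rparr>"
  have UNIV: "set cs = UNIV"
    using cs by (metis card_subset_eq distinct_card finite_class.finite_UNIV subset_UNIV)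
  have weighted: "weighted_graph G"
    using nonneg by (auto simp: G_def weighted_graph_def card_insert_if)
  have "is_cycle_graph G"
    unfolding is_cycle_graph_def
    by (intro exI[of _ cs] exI[of _ "[0..<CARD('n)]"])
      (use cs UNIV in \<open>auto simp: G_def v_def\<close>)
  moreover have "cyclic_labelling G v (\<lambda>k. k mod CARD('n)) CARD('n)"
  proof
    show "bij_betw v {..<CARD('n)} (verts G)"
      using bij_betw_nth[OF cs(1), of "{..<CARD('n)}" "set cs"] cs(2) UNIV
      by (subst bij_betw_cong[where g = "(!) cs"]) (auto simp: v_def G_def)
    show "bij_betw (\<lambda>k. k mod CARD('n)) {..<CARD('n)} (edges G)"
      by (subst bij_betw_cong[where g = id]) (auto simp: G_def)
    show "ends G (k mod CARD('n)) = {v k, v (Suc k)}" for k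
      by (simp add: G_def v_def mod_Suc_eq)
  qed (use weighted in \<open>auto simp: v_def\<close>)
  ultimately show ?thesis using that[of G] by (simp add: G_def)
qed

lemma (in cyclic_labelling) distances_of_consecutive_vertices:
  assumes dist: "\<And>a s. s < n \<Longrightarrow>
      \<exists>p. is_shortest_path G (v a) (v (a + s)) p \<and> path_length G p = D (v a) (v (a + s))"
    and s: "0 < s" "s < n"
  shows "D (v a) (v (a + s)) = min (\<Sum>t = 0..<s. D (v (a + t)) (v (Suc (a + t))))
      (\<Sum>t = s..<n. D (v (a + t)) (v (Suc (a + t))))"
proof -
  let ?w = "\<lambda>k. weight G (e k)" and ?W = "sum (weight G) (edges G)"
  have eq: "D (v a) (v (a + s)) = min (\<Sum>t = 0..<s. ?w (a + t)) (\<Sum>t = s..<n. ?w (a + t))"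
    if "s < n" for a s
    using shortest_path[OF that] dist[OF that] by blast
  have split: "(\<Sum>t = 0..<s. ?w (a + t)) + (\<Sum>t = s..<n. ?w (a + t)) = ?W" if "s < n" for a s
    using cyclic_labelling.arc_split[OF shift[of a], of s] that by simp
  \<comment> \<open>This is \<open>s = 1\<close> in \<open>eq\<close> and \<open>split\<close>: one
    arc is a single edge, the other is all the rest. It is available because \<open>0 < s\<close>
    and \<open>s < n\<close> force \<open>1 < n\<close>.\<close>
  have "D (v k) (v (Suc k)) = min (?w k) (?W - ?w k)" for k
    using eq[of 1 k] split[of 1 k] s by (simp add: algebra_simps)
  moreover have "0 \<le> ?w (a + t)" if "t < n" for t
    using cyclic_labelling.edge[OF shift[of a] that] weight_nonneg by simp
  ultimately have "min (\<Sum>t = 0..<s. ?w (a + t)) (\<Sum>t = s..<n. ?w (a + t)) =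
      min (\<Sum>t = 0..<s. D (v (a + t)) (v (Suc (a + t))))
        (\<Sum>t = s..<n. D (v (a + t)) (v (Suc (a + t))))"
    using s split[of s a] by (intro min_sum_replace_heavy[where W = ?W]) auto
  then show ?thesis using eq[OF s(2)] by simp
qed

theorem theorem3p1:
  fixes D :: "real ^ 'n ^ 'n"
  assumes "distance_matrix D"
  shows "has_cycle_realization D \<longleftrightarrow>
    (\<exists>\<pi> :: 'n \<Rightarrow> 'n. real_permutation \<pi> \<and>
      (\<forall>i. \<forall>s \<in> {1..CARD('n) - 1}.
         D $ i $ (\<pi> ^^ s) i =
           min (\<Sum>t = 0..s - 1. D $ (\<pi> ^^ t) i $ (\<pi> ^^ (t + 1)) i)
               (\<Sum>t = s..CARD('n) - 1. D $ (\<pi> ^^ t) i $ (\<pi> ^^ (t + 1)) i)))"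
    (is "_ \<longleftrightarrow> (\<exists>\<pi>. real_permutation \<pi> \<and> ?cond \<pi>)")
proof
  assume "has_cycle_realization D"
  then obtain G :: "('n, nat) wgraph" where G: "weighted_graph G" "is_cycle_graph G"
    "verts G = UNIV" and dist: "\<And>i j. \<exists>p. is_shortest_path G i j p \<and> path_length G p = D $ i $ j"
    unfolding has_cycle_realization_def by blast
  obtain vs e where vs: "distinct vs" "set vs = verts G"
    "cyclic_labelling G (\<lambda>k. vs ! (k mod length vs)) e (length vs)"
    using labelling_of_cycle_graph[OF G(1,2)] by blast
  have len: "length vs = CARD('n)"
    using distinct_card[OF vs(1)] vs(2) G(3) by simp
  have "?cond (cycle_of_list vs)"
    unfolding real_permutation_condition_iff[OF vs(1) len]
    using cyclic_labelling.distances_of_consecutive_vertices[OF vs(3)[unfolded len],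
        of "\<lambda>i j. D $ i $ j"] dist
    by blast
  then show "\<exists>\<pi>. real_permutation \<pi> \<and> ?cond \<pi>"
    using vs(1) len unfolding real_permutation_def by blast
next
  assume "\<exists>\<pi>. real_permutation \<pi> \<and> ?cond \<pi>"
  then obtain cs where cs: "distinct cs" "length cs = CARD('n)" "?cond (cycle_of_list cs)"
    unfolding real_permutation_def by blast
  define n where "n = CARD('n)"
  define v where "v k = cs ! (k mod n)" for k
  define w where "w k = D $ v k $ v (Suc k)" for k
  have nonneg: "0 \<le> w k" for k
    using assms by (simp add: distance_matrix_def w_def)
  \<comment> \<open>A realization also needs the pairs \<open>i = j\<close>, so the condition is
    extended to \<open>s = 0\<close>, where the first sum is empty and both sides are zero.\<close>
  have cond: "D $ v a $ v (a + s) = min (\<Sum>t = 0..<s. w (a + t)) (\<Sum>t = s..<n. w (a + t))"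
    if "s < n" for a s
  proof (cases "s = 0")
    case True
    then show ?thesis
      using assms nonneg by (simp add: distance_matrix_def sum_nonneg)
  next
    case False
    then show ?thesis
      using cs(3) that unfolding real_permutation_condition_iff[OF cs(1,2)]
      by (simp add: w_def v_def n_def)
  qed
  obtain G :: "('n, nat) wgraph" where G: "is_cycle_graph G" "verts G = UNIV" "weight G = w"
    and "cyclic_labelling G v (\<lambda>k. k mod n) n"
    using cycle_graph_of_list[OF cs(1,2), of w] nonneg unfolding v_def[abs_def] n_def by blast
  then interpret cyclic_labelling G v "\<lambda>k. k mod n" n by simp
  \<comment> \<open>In \<open>G\<close> the edge at index \<open>k\<close> is named
    \<open>k mod n\<close>; periodicity of \<open>v\<close> gives it the intended weight
    \<open>w k\<close>.\<close>
  have w_mod: "w (k mod n) = w k" for k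
    by (simp add: w_def v_def mod_Suc_eq)
  have "\<exists>p. is_shortest_path G i j p \<and> path_length G p = D $ i $ j" for i j
  proof -
    obtain a where a: "i = v a"
      using bij_v G(2) by (metis UNIV_I bij_betw_imp_surj_on imageE)
    obtain s where s: "s < n" "j = v (a + s)"
      using cyclic_labelling.bij_v[OF shift[of a]] G(2)
      by (metis UNIV_I bij_betw_imp_surj_on imageE lessThan_iff)
    show ?thesis
      unfolding a s(2) shortest_path[OF s(1)] using cond[OF s(1)] G(3) w_mod by simp
  qed
  then show "has_cycle_realization D"
    unfolding has_cycle_realization_def using G weighted by blast
qed

end
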